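(* Let $t=w-\delta+1$ and $r=\max\left\{0,\left\lceil \frac{\delta(w-\delta)}{n-d}-1\right\rceil\right\}$, where $d=2\delta$. Then $$A(n,2\delta,w)\le \frac{\binom{n}{w}}{\sum_{i=t+r}^{w}\binom{t+2r}{i}\binom{n-t-2r}{w-i}},$$ with $\binom{n}{k}=0$ when $k>n$.
   Context: $A(n,2\delta,w)$ denotes the maximum possible number of codewords in a binary code of length $n$ (a subset of $\{0,1\}^n$), constant weight $w$ (every codeword has exactly $w$ nonzero entries) and minimum distance $2\delta$ (any two distinct codewords have Hamming distance at least $2\delta$). The Hamming distance of two sequences is the number of positions in which they differ. The convention on binomial coefficients is meant for every binomial coefficient in the formula. *)

theory Defs
  imports Complex_Main
begin

(* A word of length n is a list of n Booleans, True standing for the symbol 1. *)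

definition hamming_weight :: "bool list \<Rightarrow> nat" where
  "hamming_weight x = card {i. i < length x \<and> x ! i}"

text \<open>Only used for words of equal length.\<close>
definition hamming_dist :: "bool list \<Rightarrow> bool list \<Rightarrow> nat" where
  "hamming_dist x y = card {i. i < length x \<and> x ! i \<noteq> y ! i}"

definition constant_weight_code :: "nat \<Rightarrow> nat \<Rightarrow> nat \<Rightarrow> bool list set \<Rightarrow> bool" where
  "constant_weight_code n d w C \<longleftrightarrow>
     C \<subseteq> {x. length x = n} \<and>
     (\<forall>x\<in>C. hamming_weight x = w) \<and>
     (\<forall>x\<in>C. \<forall>y\<in>C. x \<noteq> y \<longrightarrow> d \<le> hamming_dist x y)"

definition max_code_size :: "nat \<Rightarrow> nat \<Rightarrow> nat \<Rightarrow> nat" where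
  "max_code_size n d w = Max {card C |C. constant_weight_code n d w C}"

text \<open>The maximum is taken over a finite nonempty set of sizes of finite codes.\<close>

lemma finite_constant_weight_code:
  assumes "constant_weight_code n d w C"
  shows "finite C"
proof (rule finite_subset)
  show "C \<subseteq> {x. set x \<subseteq> UNIV \<and> length x = n}"
    using assms by (auto simp: constant_weight_code_def)
qed (rule finite_lists_length_eq, simp)

lemma finite_constant_weight_codes: "finite {C. constant_weight_code n d w C}"
proof (rule finite_subset)
  show "{C. constant_weight_code n d w C} \<subseteq> Pow {x. set x \<subseteq> UNIV \<and> length x = n}"
    by (auto simp: constant_weight_code_def)
  show "finite (Pow {x :: bool list. set x \<subseteq> UNIV \<and> length x = n})"
    using finite_lists_length_eq[of "UNIV :: bool set" n] by simp
qed

lemma constant_weight_code_empty: "constant_weight_code n d w {}"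
  by (simp add: constant_weight_code_def)

text \<open>
  The arguments of the binomial coefficients are differences that may be negative, so
  truncated subtraction on the naturals would give wrong values. The coefficient vanishes
  unless \<open>0 \<le> k \<le> n\<close>; in particular it vanishes for all negative \<open>n\<close>, unlike
  the generalised coefficient \<^term>\<open>n gchoose k\<close>.
\<close>
definition int_binomial :: "int \<Rightarrow> int \<Rightarrow> nat" where
  "int_binomial n k = (if 0 \<le> k \<and> k \<le> n then nat n choose nat k else 0)"

end

theory Submission
  imports Defs "HOL-Combinatorics.Permutations"
begin

text \<open>
  The words of weight \<open>w\<close> with at least \<open>t + r\<close> ones among the first \<open>t + 2r\<close> positions
  pairwise share at least \<open>t\<close> ones, so they form an anticode of diameter at most \<open>2\<delta> - 2\<close>.
  A permuted copy of the code therefore meets the anticode at most once. Averaging over all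
  permutations gives the bound.
\<close>

section \<open>Permutations carrying one subset onto another\<close>

text \<open>Equal sizes of \<open>S\<close> and \<open>T\<close> make their complements in
  \<open>U\<close> equinumerous too, so a bijection between the sets and one between the complements
  glue to a permutation.\<close>

lemma exists_permutation_mapping_set:
  assumes "finite U" "S \<subseteq> U" "T \<subseteq> U" "card S = card T"
  shows "\<exists>p. p permutes U \<and> p ` S = T"
proof -
  have fin: "finite S" "finite T"
    using assms finite_subset by blast+
  obtain f where f: "bij_betw f S T"
    using finite_same_card_bij[OF fin assms(4)] by blast
  have "card (U - S) = card (U - T)"
    using assms fin by (simp add: card_Diff_subset)
  then obtain g where g: "bij_betw g (U - S) (U - T)"
    using finite_same_card_bij[of "U - S" "U - T"] assms(1) by blast
  define p where "p x = (if x \<in> S then f x else if x \<in> U then g x else x)" for x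
  have pS: "bij_betw p S T"
    using f by (rule bij_betw_cong[THEN iffD1, rotated]) (simp add: p_def)
  have "bij_betw p (U - S) (U - T)"
    using g by (rule bij_betw_cong[THEN iffD1, rotated]) (simp add: p_def)
  then have "bij_betw p (S \<union> (U - S)) (T \<union> (U - T))"
    using pS by (intro bij_betw_combine) auto
  then have "bij_betw p U U"
    using assms by (simp add: Un_absorb1)
  then have "p permutes U"
    using assms(2) by (intro bij_imp_permutes) (auto simp: p_def)
  with pS show ?thesis
    by (auto simp: bij_betw_def)
qed

text \<open>Composing with a permutation that takes \<open>T'\<close> onto \<open>T\<close> matches
  the permutations sending \<open>S\<close> to \<open>T'\<close> with those sending it to
  \<open>T\<close>. Hence all permutations of \<open>U\<close> are spread evenly over the possible
  images of \<open>S\<close>. The product form avoids division on the naturals.\<close>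

lemma card_permutations_mapping_set:
  assumes "finite U" "S \<subseteq> U" "T \<subseteq> U" "card S = card T"
  shows "card {p. p permutes U \<and> p ` S = T} * (card U choose card S) = fact (card U)"
proof -
  define P where "P T' = {p. p permutes U \<and> p ` S = T'}" for T'
  let ?\<T> = "{T'. T' \<subseteq> U \<and> card T' = card S}"
  have finP: "finite (P T')" for T'
    using finite_permutations[OF assms(1)] by (simp add: P_def)
  have eq: "card (P T') = card (P T)" if T': "T' \<in> ?\<T>" for T'
  proof -
    obtain q where q: "q permutes U" "q ` T' = T"
      using exists_permutation_mapping_set[of U T' T] T' assms by auto
    have "bij_betw ((\<circ>) q) (P T') (P T)"
    proof (rule bij_betw_byWitness[where f' = "(\<circ>) (inv q)"])
      show "\<forall>p\<in>P T'. inv q \<circ> (q \<circ> p) = p"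
        by (simp add: fun_eq_iff permutes_inverses[OF q(1)])
      show "\<forall>p\<in>P T. q \<circ> (inv q \<circ> p) = p"
        by (simp add: fun_eq_iff permutes_inverses[OF q(1)])
      show "(\<circ>) q ` P T' \<subseteq> P T"
        using q by (auto simp: P_def image_image[of q] intro: permutes_compose)
      have "inv q ` T = T'"
        using q permutes_inj[OF q(1)] by (auto simp: image_inv_f_f)
      then show "(\<circ>) (inv q) ` P T \<subseteq> P T'"
        using permutes_inv[OF q(1)]
        by (auto simp: P_def image_image[of "inv q"] intro: permutes_compose)
    qed
    then show ?thesis
      by (rule bij_betw_same_card)
  qed
  have "{p. p permutes U} = (\<Union>T'\<in>?\<T>. P T')"
  proof -
    have "p ` S \<subseteq> U \<and> card (p ` S) = card S" if "p permutes U" for p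
      using that assms(2) permutes_image[OF that] permutes_inj_on[OF that]
      by (metis card_image image_mono)
    then show ?thesis
      by (auto simp: P_def)
  qed
  then have "fact (card U) = card (\<Union>T'\<in>?\<T>. P T')"
    using card_permutations[OF refl assms(1)] by simp
  also have "\<dots> = (\<Sum>T'\<in>?\<T>. card (P T'))"
    using assms(1) finP by (intro card_UN_disjoint) (auto simp: P_def)
  also have "\<dots> = (\<Sum>T'\<in>?\<T>. card (P T))"
    using eq by (rule sum.cong[OF refl])
  also have "\<dots> = (card U choose card S) * card (P T)"
    using n_subsets[OF assms(1), of "card S"] by simp
  finally show ?thesis
    by (simp add: P_def mult.commute)
qed

section \<open>Codes against anticodes\<close>

lemma code_anticode_bound:
  assumes "finite U"
    and C: "\<And>c. c \<in> C \<Longrightarrow> c \<subseteq> U \<and> card c = w"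
    and A: "\<And>a. a \<in> A \<Longrightarrow> a \<subseteq> U \<and> card a = w"
    and inter: "\<And>c c' a a'. \<lbrakk>c \<in> C; c' \<in> C; c \<noteq> c'; a \<in> A; a' \<in> A\<rbrakk>
                  \<Longrightarrow> card (c \<inter> c') < card (a \<inter> a')"
  shows "card C * card A \<le> card U choose w"
proof -
  let ?P = "{p. p permutes U}"
  define B where "B = card U choose w"
  have finP: "finite ?P"
    using assms(1) by (rule finite_permutations)
  have "C \<subseteq> Pow U" "A \<subseteq> Pow U"
    using C A by blast+
  then have finC: "finite C" and finA: "finite A"
    using assms(1) by (simp_all add: finite_subset)
  have count: "card {p \<in> ?P. p ` c = a} * B = fact (card U)" if "c \<in> C" "a \<in> A" for c a
    using card_permutations_mapping_set[OF assms(1), of c a] C[OF that(1)] A[OF that(2)]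
    by (simp add: B_def)
  have one: "card {c \<in> C. p ` c \<in> A} \<le> 1" if p: "p permutes U" for p
  proof -
    have "c = c'" if "c \<in> C" "c' \<in> C" "p ` c \<in> A" "p ` c' \<in> A" for c c'
    \<comment> \<open>A permutation preserves intersection sizes, so two distinct codewords with
      images in \<open>A\<close> would make \<open>card (c \<inter> c')\<close> smaller than
      itself.\<close>
    proof (rule ccontr)
      assume "c \<noteq> c'"
      then have "card (c \<inter> c') < card (p ` c \<inter> p ` c')"
        using that by (intro inter)
      also have "p ` c \<inter> p ` c' = p ` (c \<inter> c')"
        by (rule image_Int[OF permutes_inj[OF p], symmetric])
      also have "card \<dots> = card (c \<inter> c')"
        by (rule card_image[OF permutes_inj_on[OF p]])
      finally show False
        by simp
    qed
    then show ?thesis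
      using card_le_Suc0_iff_eq[of "{c \<in> C. p ` c \<in> A}"] finC by simp
  qed
  \<comment> \<open>By \<open>count\<close>, each pair \<open>(c, a)\<close> accounts for one copy
    of \<open>fact (card U)\<close>; the factor \<open>B\<close> is carried along so that everything
    stays exact on the naturals.\<close>
  have "card C * card A * fact (card U) = (\<Sum>c\<in>C. \<Sum>a\<in>A. card {p \<in> ?P. p ` c = a} * B)"
    using count by simp
  also have "\<dots> = (\<Sum>c\<in>C. \<Sum>a\<in>A. card {p \<in> ?P. p ` c = a}) * B"
    by (simp add: sum_distrib_right)
  also have "(\<Sum>c\<in>C. \<Sum>a\<in>A. card {p \<in> ?P. p ` c = a}) = (\<Sum>c\<in>C. card {p \<in> ?P. p ` c \<in> A})"
  proof (rule sum.cong[OF refl])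
    fix c
    have "{p \<in> ?P. p ` c \<in> A} = (\<Union>a\<in>A. {p \<in> ?P. p ` c = a})"
      by auto
    then show "(\<Sum>a\<in>A. card {p \<in> ?P. p ` c = a}) = card {p \<in> ?P. p ` c \<in> A}"
      using finA finP by (simp only:) (subst card_UN_disjoint, auto)
  qed
  \<comment> \<open>Exchange of the order of summation; now \<open>one\<close> bounds each
    summand.\<close>
  also have "\<dots> = (\<Sum>p\<in>?P. card {c \<in> C. p ` c \<in> A})"
    using finC finP by (rule sum_multicount_gen) simp
  also have "\<dots> * B \<le> (\<Sum>p\<in>?P. 1) * B"
    using one by (intro mult_right_mono sum_mono) auto
  also have "\<dots> = B * fact (card U)"
    using card_permutations[OF refl assms(1)] by simp
  finally show ?thesis
    by (simp add: B_def)
qed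

section \<open>The size of the anticode\<close>

lemma card_subsets_with_intersection_sizes:
  assumes "finite M" "finite N" "M \<inter> N = {}"
  shows "card {X. X \<subseteq> M \<union> N \<and> card (X \<inter> M) = k \<and> card (X \<inter> N) = l}
           = (card M choose k) * (card N choose l)"
proof -
  have "bij_betw (\<lambda>(Y, Z). Y \<union> Z)
      ({Y. Y \<subseteq> M \<and> card Y = k} \<times> {Z. Z \<subseteq> N \<and> card Z = l})
      {X. X \<subseteq> M \<union> N \<and> card (X \<inter> M) = k \<and> card (X \<inter> N) = l}"
  proof (rule bij_betw_byWitness[where f' = "\<lambda>X. (X \<inter> M, X \<inter> N)"])
    have restrict: "(Y \<union> Z) \<inter> M = Y" "(Y \<union> Z) \<inter> N = Z" if "Y \<subseteq> M" "Z \<subseteq> N" for Y Z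
      using that assms(3) by auto
    then show "\<forall>a\<in>{Y. Y \<subseteq> M \<and> card Y = k} \<times> {Z. Z \<subseteq> N \<and> card Z = l}.
        ((case a of (Y, Z) \<Rightarrow> Y \<union> Z) \<inter> M, (case a of (Y, Z) \<Rightarrow> Y \<union> Z) \<inter> N) = a"
      by auto
    show "(\<lambda>(Y, Z). Y \<union> Z) ` ({Y. Y \<subseteq> M \<and> card Y = k} \<times> {Z. Z \<subseteq> N \<and> card Z = l})
        \<subseteq> {X. X \<subseteq> M \<union> N \<and> card (X \<inter> M) = k \<and> card (X \<inter> N) = l}"
      using restrict by auto
  qed auto
  from bij_betw_same_card[OF this] show ?thesis
    using assms by (simp add: card_cartesian_product n_subsets)
qed

lemma int_binomial_of_nat [simp]: "int_binomial (int a) (int b) = a choose b"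
  by (simp add: int_binomial_def)

lemma int_binomial_eq_0:
  "k < 0 \<Longrightarrow> int_binomial m k = 0" "m < 0 \<Longrightarrow> int_binomial m k = 0"
  by (simp_all add: int_binomial_def)

text \<open>The sets are sorted by the size of their trace on \<open>M\<close>. The bound
  \<open>s\<close> is an integer because it will be \<open>t + r\<close>, which may be negative; a
  negative index gives an empty class and a zero coefficient.\<close>

lemma card_subsets_with_large_intersection:
  assumes "finite U" "M \<subseteq> U"
  shows "card {X. X \<subseteq> U \<and> card X = w \<and> s \<le> int (card (X \<inter> M))}
           = (\<Sum>i = s..int w.
               int_binomial (card M) i * int_binomial (int (card U) - card M) (int w - i))"
proof -
  define F where "F i = {X. X \<subseteq> U \<and> card X = w \<and> int (card (X \<inter> M)) = i}" for i
  have finM: "finite M"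
    using assms finite_subset by blast
  have le: "card (X \<inter> M) \<le> card X" if "X \<subseteq> U" for X
    using that assms(1) by (meson card_mono finite_subset inf_le1)
  have "{X. X \<subseteq> U \<and> card X = w \<and> s \<le> int (card (X \<inter> M))} = (\<Union>i\<in>{s..int w}. F i)"
    using le by (force simp: F_def)
  then have "card {X. X \<subseteq> U \<and> card X = w \<and> s \<le> int (card (X \<inter> M))}
      = (\<Sum>i = s..int w. card (F i))"
    using assms(1) by (simp only:) (subst card_UN_disjoint, auto simp: F_def)
  also have "\<dots> = (\<Sum>i = s..int w.
               int_binomial (card M) i * int_binomial (int (card U) - card M) (int w - i))"
  proof (rule sum.cong[OF refl])
    fix i
    assume i: "i \<in> {s..int w}"
    show "card (F i) = int_binomial (card M) i * int_binomial (int (card U) - card M) (int w - i)"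
    proof (cases "i < 0")
      case True
      then show ?thesis
        by (simp add: F_def int_binomial_eq_0)
    next
      case False
      then have "i = int (nat i)" "nat i \<le> w"
        using i by auto
      then obtain k where k: "i = int k" "k \<le> w"
        by blast
      \<comment> \<open>The truncated difference \<open>w - k\<close> is exact because
        \<open>k \<le> w\<close>, so the total size and the trace on \<open>M\<close> determine the
        size of the rest.\<close>
      have split: "card X = w \<and> int (card (X \<inter> M)) = i
          \<longleftrightarrow> card (X \<inter> M) = k \<and> card (X \<inter> (U - M)) = w - k" if "X \<subseteq> U" for X
      proof -
        have "X = (X \<inter> M) \<union> (X \<inter> (U - M))"
          using that by auto
        moreover have "finite X"
          using that assms(1) finite_subset by blast
        ultimately have "card X = card (X \<inter> M) + card (X \<inter> (U - M))"
          by (subst card_Un_disjoint[symmetric]) auto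
        then show ?thesis
          using k by auto
      qed
      have "F i = {X. X \<subseteq> M \<union> (U - M) \<and> card (X \<inter> M) = k \<and> card (X \<inter> (U - M)) = w - k}"
        using split assms(2) by (auto simp: F_def Un_absorb1 simp del: Un_Diff_cancel)
      then have "card (F i) = (card M choose k) * (card (U - M) choose (w - k))"
        using card_subsets_with_intersection_sizes[of M "U - M" k "w - k"] finM assms(1)
        by (simp del: Un_Diff_cancel)
      moreover have "int (card U) - card M = int (card (U - M))"
        using assms finM by (simp add: card_Diff_subset card_mono of_nat_diff)
      moreover have "int w - i = int (w - k)"
        using k by simp
      ultimately show ?thesis
        by (simp only: k(1) int_binomial_of_nat)
    qed
  qed
  finally show ?thesis .
qed

section \<open>Words and their supports\<close>

text \<open>The distance is the size of the symmetric difference of the supports, and each weight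
  counts the common ones once. This turns distance conditions into conditions on
  intersections.\<close>

lemma hamming_dist_add_card_inter:
  assumes "length x = length y"
  shows "hamming_dist x y + 2 * card ({i. i < length x \<and> x ! i} \<inter> {i. i < length y \<and> y ! i})
           = hamming_weight x + hamming_weight y"
proof -
  define S T where "S = {i. i < length x \<and> x ! i}" and "T = {i. i < length y \<and> y ! i}"
  have fin: "finite S" "finite T"
    by (simp_all add: S_def T_def)
  have "{i. i < length x \<and> x ! i \<noteq> y ! i} = (S - T) \<union> (T - S)"
    using assms by (auto simp: S_def T_def)
  then have "hamming_dist x y = card (S - T) + card (T - S)"
    using fin by (simp add: hamming_dist_def) (subst card_Un_disjoint, auto)
  moreover have "card S = card (S \<inter> T) + card (S - T)"
    using fin card_Int_Diff by blast
  moreover have "card T = card (S \<inter> T) + card (T - S)"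
    using fin card_Int_Diff[of T S] by (simp add: Int_commute)
  ultimately show ?thesis
    by (simp add: hamming_weight_def flip: S_def T_def)
qed

text \<open>The fixed length matters: trailing \<open>False\<close> entries leave no trace in the
  support.\<close>

lemma inj_on_support: "inj_on (\<lambda>x. {i. i < length x \<and> x ! i}) {x. length x = n}"
proof (rule inj_onI)
  fix x y
  assume n: "x \<in> {x. length x = n}" "y \<in> {x. length x = n}"
    and supp: "{i. i < length x \<and> x ! i} = {i. i < length y \<and> y ! i}"
  have len: "length x = length y"
    using n by simp
  have "x ! i = y ! i" if "i < length x" for i
    using that len eqset_imp_iff[OF supp, of i] by simp
  with len show "x = y"
    by (rule nth_equalityI)
qed

section \<open>The bound for constant weight codes\<close>

text \<open>Since \<open>x / 0 = 0\<close> in HOL, \<open>n \<noteq> d\<close> and the nonvanishing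
  of the sum keep both quotients meaningful. \<open>t\<close> and \<open>r\<close> are integers
  because \<open>t\<close> is negative when \<delta> exceeds \<open>w + 1\<close>.\<close>

theorem lemma14:
  fixes n w \<delta> d :: nat and t r :: int
  assumes "d = 2 * \<delta>"
    and "n \<noteq> d"
    and "t = int w - int \<delta> + 1"
    and "r = max 0 \<lceil>real \<delta> * (real w - real \<delta>) / (real n - real d) - 1\<rceil>"
    and "(\<Sum>i = t + r..int w.
            int_binomial (t + 2 * r) i * int_binomial (int n - t - 2 * r) (int w - i)) \<noteq> 0"
  shows "real (max_code_size n (2 * \<delta>) w)
           \<le> real (int_binomial (int n) (int w)) /
             real (\<Sum>i = t + r..int w.
               int_binomial (t + 2 * r) i * int_binomial (int n - t - 2 * r) (int w - i))"
proof -
  define D where "D = (\<Sum>i = t + r..int w.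
      int_binomial (t + 2 * r) i * int_binomial (int n - t - 2 * r) (int w - i))"
  have D0: "D \<noteq> 0"
    using assms(5) by (simp add: D_def)
  \<comment> \<open>A negative upper argument kills every summand. So \<open>D0\<close> makes
    \<open>t + 2 * r\<close> a natural number \<open>m \<le> n\<close>, the number of distinguished
    positions.\<close>
  have "D = 0" if "t + 2 * r < 0 \<or> int n - t - 2 * r < 0"
    using that by (auto simp: D_def int_binomial_eq_0)
  with D0 have "0 \<le> t + 2 * r" "0 \<le> int n - t - 2 * r"
    by force+
  then obtain m where m: "t + 2 * r = int m" "m \<le> n"
    using nonneg_int_cases[of "t + 2 * r"] by force
  \<comment> \<open>For \<open>t \<ge> 1\<close> this is a Frankl family, a standard example of a
    \<open>t\<close>-intersecting family.\<close>
  define A where "A = {X. X \<subseteq> {..<n} \<and> card X = w \<and> t + r \<le> int (card (X \<inter> {..<m}))}"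
  have "int n - t - 2 * r = int n - int m"
    using m(1) by simp
  then have D: "D = card A"
    using card_subsets_with_large_intersection[of "{..<n}" "{..<m}" w "t + r"] m
    by (simp only: D_def A_def) simp
  \<comment> \<open>Inclusion-exclusion within the first \<open>m\<close> positions: two traces of
    size at least \<open>t + r\<close> with a union of size at most \<open>t + 2 * r\<close> overlap
    in at least \<open>2 * (t + r) - (t + 2 * r) = t\<close> positions.\<close>
  have A_inter: "t \<le> int (card (a \<inter> a'))" if "a \<in> A" "a' \<in> A" for a a'
  proof -
    let ?X = "a \<inter> {..<m}" and ?Y = "a' \<inter> {..<m}"
    have "card ?X + card ?Y = card (?X \<union> ?Y) + card (?X \<inter> ?Y)"
      by (intro card_Un_Int) auto
    moreover have "card (?X \<union> ?Y) \<le> m"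
      using card_mono[of "{..<m}" "?X \<union> ?Y"] by auto
    moreover have "card (?X \<inter> ?Y) \<le> card (a \<inter> a')"
      using that by (intro card_mono) (auto simp: A_def intro: finite_subset[of _ "{..<n}"])
    ultimately show ?thesis
      using that m(1) by (simp add: A_def)
  qed
  have "max_code_size n (2 * \<delta>) w \<in> {card C |C. constant_weight_code n (2 * \<delta>) w C}"
    unfolding max_code_size_def
  proof (rule Max_in)
    show "finite {card C |C. constant_weight_code n (2 * \<delta>) w C}"
      using finite_imageI[OF finite_constant_weight_codes, of card] by (simp add: setcompr_eq_image)
    show "{card C |C. constant_weight_code n (2 * \<delta>) w C} \<noteq> {}"
      using constant_weight_code_empty by blast
  qed
  then obtain C where C: "constant_weight_code n (2 * \<delta>) w C"
    and card_C: "max_code_size n (2 * \<delta>) w = card C"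
    by auto
  define supp where "supp x = {i. i < length x \<and> x ! i}" for x :: "bool list"
  have len: "length x = n" and wt: "hamming_weight x = w" if "x \<in> C" for x
    using C that by (auto simp: constant_weight_code_def)
  have "inj_on supp C"
    unfolding supp_def using len by (intro inj_on_subset[OF inj_on_support[of n]]) auto
  then have "card C = card (supp ` C)"
    by (simp add: card_image)
  moreover have "card (supp ` C) * card A \<le> card {..<n} choose w"
  proof (rule code_anticode_bound)
    show "c \<subseteq> {..<n} \<and> card c = w" if "c \<in> supp ` C" for c
      using that len wt by (auto simp: supp_def hamming_weight_def)
    fix c c' a a'
    assume "c \<in> supp ` C" "c' \<in> supp ` C" "c \<noteq> c'" and a: "a \<in> A" "a' \<in> A"
    then obtain x y where xy: "x \<in> C" "y \<in> C" "x \<noteq> y" "c = supp x" "c' = supp y"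
      by auto
    then have "2 * \<delta> \<le> hamming_dist x y"
      using C by (auto simp: constant_weight_code_def)
    moreover have "hamming_dist x y + 2 * card (c \<inter> c') = 2 * w"
      using hamming_dist_add_card_inter[of x y] xy len wt by (simp add: supp_def)
    \<comment> \<open>The distance leaves codewords at most \<open>w - \<delta> = t - 1\<close>
      common ones, one fewer than the \<open>t\<close> guaranteed in \<open>A\<close>; this is where
      the \<open>+ 1\<close> in \<open>t\<close> is used.\<close>
    ultimately show "card (c \<inter> c') < card (a \<inter> a')"
      using A_inter[OF a] assms(3) by linarith
  qed (auto simp: A_def)
  ultimately have "card C * D \<le> n choose w"
    by (simp add: D)
  then have "real (card C) * real D \<le> real (n choose w)"
    by (metis of_nat_le_iff of_nat_mult)
  then have "real (card C) \<le> real (n choose w) / real D"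
    using D0 by (simp add: pos_le_divide_eq)
  then show ?thesis
    by (simp only: card_C D_def int_binomial_of_nat)
qed

end
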